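(* In the battery-sharing model described in the context (any battery capacity $b_{\max}\in\mathbb{N}$, any initial distribution), under every policy that satisfies the fairness constraints $\mathrm{FC}_i$ for all $i\in[n]$, $$\mathrm{LLR}_{\rm sys}\ \ge\ \sum_{i\in\mathscr{D}}(-\Delta_i).$$
   Context: Notation: $[n]=\{1,\dots,n\}$; $\mathbb{I}\{\cdot\}$ denotes an indicator. Net generation. There are $n$ users. The net generation of user $i$ at discrete time $t$ is $X_i(t)\in S_i\subset\mathbb{Z}$ (positive: surplus; negative: deficit), where $S_i$ has $\max S_i>0$ and $\min S_i<0$. The vector $X(t)=(X_1(t),\dots,X_n(t))$ is an irreducible discrete-time Markov chain on a finite state space $S\subseteq\prod_{i\in[n]}S_i$ (the users' processes need not be independent), with $\mathbb{P}[X(t+1)=s\mid X(t)=s]>0$ for all $s\in S$. Its stationary distribution is $\pi$. The drift of user $i$ is $\Delta_i=\sum_{s\in S}s_i\pi(s)$, where $s=(s_1,\dots,s_n)$. The set of net demanding users is $\mathscr{D}=\{i\in[n]:\Delta_i<0\}$. Battery. A shared battery of capacity $b_{\max}\in\mathbb{N}$ has level $B(t)\in\{0,\dots,b_{\max}\}$ and evolves as $B(t+1)=B(t)+\sum_{i\in[n]}A_i(t)$, where $A_i(t)$ is the energy accepted from user $i$ (if $\ge0$) or supplied to user $i$ (if negative). In state $(x,b)\in S\times\{0,\dots,b_{\max}\}$ the set $A(x,b)$ of allowable actions consists of all integer vectors $(a_1,\dots,a_n)$ with $a_i\in\{0,\dots,x_i\}$ if $x_i\ge0$, $a_i\in\{x_i,\dots,0\}$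 if $x_i<0$, and $0\le b+\sum_{i}a_i\le b_{\max}$. A policy is a (possibly randomized, history-dependent) rule choosing at each time $t$ an action in $A(X(t),B(t))$ as a function of the history up to time $t$; the process $X$ evolves autonomously, unaffected by actions. The initial distribution of $(X(0),B(0))$ is fixed. Loss of load rate: $\mathrm{LLR}_i=\lim_{T\to\infty}\frac1T\sum_{t=0}^T\mathbb{E}\big[\mathbb{I}\{X_i(t)<0\}(A_i(t)-X_i(t))\big]$ and $\mathrm{LLR}_{\rm sys}=\sum_{i\in[n]}\mathrm{LLR}_i$. Fairness constraint for user $i$: $\mathrm{FC}_i:\ \lim_{T\to\infty}\frac1T\sum_{t=0}^T\mathbb{E}[A_i(t)]\ge0$. The limits appearing in these definitions are understood to exist for the policies considered. *)

theory Defs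
  imports "HOL-Probability.Probability"
begin

text \<open>
  The users are the elements of a finite type \<open>'n\<close>, so \<open>n = CARD('n)\<close>. A state or an action is an
  integer vector indexed by the users. Battery levels are integers, so that no subtraction is
  truncated; that they lie in \<open>{0..int bmax}\<close> is imposed on the initial distribution and preserved
  by the allowable actions.
\<close>

type_synonym 'n vec_int = "'n \<Rightarrow> int"

subsection \<open>Net generation\<close>

text \<open>A time-homogeneous Markov chain is given by its transition kernel; only the values of the
  kernel on the state space matter.\<close>

type_synonym 's kernel = "'s \<Rightarrow> 's pmf"

definition kernel_on :: "'s set \<Rightarrow> 's kernel \<Rightarrow> bool" where
  "kernel_on S K \<longleftrightarrow> (\<forall>s\<in>S. set_pmf (K s) \<subseteq> S)"

primrec step_law :: "'s kernel \<Rightarrow> nat \<Rightarrow> 's \<Rightarrow> 's pmf" where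
  "step_law K 0 s = return_pmf s"
| "step_law K (Suc k) s = bind_pmf (step_law K k s) K"

definition irreducible_on :: "'s set \<Rightarrow> 's kernel \<Rightarrow> bool" where
  "irreducible_on S K \<longleftrightarrow> (\<forall>s\<in>S. \<forall>s'\<in>S. \<exists>k. pmf (step_law K k s) s' > 0)"

definition stationary_on :: "'s set \<Rightarrow> 's kernel \<Rightarrow> 's pmf \<Rightarrow> bool" where
  "stationary_on S K \<pi> \<longleftrightarrow> set_pmf \<pi> \<subseteq> S \<and> bind_pmf \<pi> K = \<pi>"

definition drift :: "'n vec_int set \<Rightarrow> 'n vec_int pmf \<Rightarrow> 'n \<Rightarrow> real" where
  "drift S \<pi> i = (\<Sum>s\<in>S. real_of_int (s i) * pmf \<pi> s)"

definition net_demanding :: "'n vec_int set \<Rightarrow> 'n vec_int pmf \<Rightarrow> 'n set" where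
  "net_demanding S \<pi> = {i. drift S \<pi> i < 0}"

subsection \<open>Battery and policies\<close>

definition actions :: "nat \<Rightarrow> 'n::finite vec_int \<Rightarrow> int \<Rightarrow> 'n vec_int set" where
  "actions bmax x b =
     {a. (\<forall>i. a i \<in> (if x i \<ge> 0 then {0..x i} else {x i..0})) \<and>
         0 \<le> b + (\<Sum>i\<in>UNIV. a i) \<and> b + (\<Sum>i\<in>UNIV. a i) \<le> int bmax}"

text \<open>A history at time \<open>t\<close> is the list of the triples \<open>(X(u), B(u), A(u))\<close> for \<open>u < t\<close>, latest
  first. Given it and the current \<open>X(t)\<close> and \<open>B(t)\<close>, a policy returns the conditional distribution
  of \<open>A(t)\<close>. Time need not be an argument, as it is the length of the history.\<close>

type_synonym 'n history = "('n vec_int \<times> int \<times> 'n vec_int) list"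
type_synonym 'n policy = "'n history \<Rightarrow> 'n vec_int \<Rightarrow> int \<Rightarrow> 'n vec_int pmf"

text \<open>Requiring admissibility also after histories that cannot occur is no restriction: the zero
  action is always allowable, and the values there do not influence the process.\<close>

definition admissible :: "'n::finite vec_int set \<Rightarrow> nat \<Rightarrow> 'n policy \<Rightarrow> bool" where
  "admissible S bmax \<sigma> \<longleftrightarrow>
     (\<forall>h. \<forall>x\<in>S. \<forall>b\<in>{0..int bmax}. set_pmf (\<sigma> h x b) \<subseteq> actions bmax x b)"

text \<open>Joint law of the history at time \<open>t\<close>, \<open>X(t)\<close> and \<open>B(t)\<close>. The next net generation is drawn
  from \<open>K\<close> at the current one, independently of the action and of the past.\<close>

primrec run :: "('n::finite vec_int \<times> int) pmf \<Rightarrow> 'n vec_int kernel \<Rightarrow> 'n policy \<Rightarrow> nat \<Rightarrow>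
    ('n history \<times> 'n vec_int \<times> int) pmf" where
  "run init K \<sigma> 0 = map_pmf (\<lambda>(x, b). ([], x, b)) init"
| "run init K \<sigma> (Suc t) =
     bind_pmf (run init K \<sigma> t) (\<lambda>(h, x, b).
       bind_pmf (\<sigma> h x b) (\<lambda>a.
         map_pmf (\<lambda>x'. ((x, b, a) # h, x', b + (\<Sum>i\<in>UNIV. a i))) (K x)))"

text \<open>Joint law of \<open>X(t)\<close>, \<open>B(t)\<close> and \<open>A(t)\<close>.\<close>

definition law_XBA :: "('n::finite vec_int \<times> int) pmf \<Rightarrow> 'n vec_int kernel \<Rightarrow> 'n policy \<Rightarrow> nat \<Rightarrow>
    ('n vec_int \<times> int \<times> 'n vec_int) pmf" where
  "law_XBA init K \<sigma> t =
     bind_pmf (run init K \<sigma> t) (\<lambda>(h, x, b). map_pmf (\<lambda>a. (x, b, a)) (\<sigma> h x b))"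

subsection \<open>Loss of load rate and fairness\<close>

text \<open>There are \<open>T + 1\<close> summands. The value at \<open>T = 0\<close>, where \<open>1 / 0 = 0\<close>, is irrelevant for
  the limit.\<close>

definition time_avg :: "(nat \<Rightarrow> real) \<Rightarrow> nat \<Rightarrow> real" where
  "time_avg f T = 1 / real T * (\<Sum>t=0..T. f t)"

definition loss :: "('n::finite vec_int \<times> int) pmf \<Rightarrow> 'n vec_int kernel \<Rightarrow> 'n policy \<Rightarrow> 'n \<Rightarrow>
    nat \<Rightarrow> real" where
  "loss init K \<sigma> i t = measure_pmf.expectation (law_XBA init K \<sigma> t)
     (\<lambda>(x, b, a). of_bool (x i < 0) * real_of_int (a i - x i))"

definition mean_action :: "('n::finite vec_int \<times> int) pmf \<Rightarrow> 'n vec_int kernel \<Rightarrow> 'n policy \<Rightarrow>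
    'n \<Rightarrow> nat \<Rightarrow> real" where
  "mean_action init K \<sigma> i t = measure_pmf.expectation (law_XBA init K \<sigma> t)
     (\<lambda>(x, b, a). real_of_int (a i))"

text \<open>\<^const>\<open>lim\<close> is unspecified for a divergent sequence, so \<open>LLR\<close> is meaningful only under
  \<open>LLR_exists\<close>.\<close>

definition LLR_exists :: "('n::finite vec_int \<times> int) pmf \<Rightarrow> 'n vec_int kernel \<Rightarrow> 'n policy \<Rightarrow>
    'n \<Rightarrow> bool" where
  "LLR_exists init K \<sigma> i \<longleftrightarrow> convergent (time_avg (loss init K \<sigma> i))"

definition LLR :: "('n::finite vec_int \<times> int) pmf \<Rightarrow> 'n vec_int kernel \<Rightarrow> 'n policy \<Rightarrow> 'n \<Rightarrow> real"
  where "LLR init K \<sigma> i = lim (time_avg (loss init K \<sigma> i))"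

definition LLR_sys :: "('n::finite vec_int \<times> int) pmf \<Rightarrow> 'n vec_int kernel \<Rightarrow> 'n policy \<Rightarrow> real"
  where "LLR_sys init K \<sigma> = (\<Sum>i\<in>UNIV. LLR init K \<sigma> i)"

definition FC :: "('n::finite vec_int \<times> int) pmf \<Rightarrow> 'n vec_int kernel \<Rightarrow> 'n policy \<Rightarrow> 'n \<Rightarrow> bool"
  where "FC init K \<sigma> i \<longleftrightarrow>
    convergent (time_avg (mean_action init K \<sigma> i)) \<and> lim (time_avg (mean_action init K \<sigma> i)) \<ge> 0"

end

theory Submission
  imports Defs
begin

text \<open>
  Since an allowable action satisfies \<open>a i \<le> x i\<close> whenever \<open>x i \<ge> 0\<close>, the loss of user \<open>i\<close>
  dominates \<open>a i - x i\<close> in every state; it is also nonnegative. Averaging over time, fairness makes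
  the mean of \<open>a i\<close> nonnegative and ergodicity makes the mean of \<open>x i\<close> equal to the drift.
  Ergodicity comes from Doeblin's argument: self-loops and irreducibility give a state that is
  reached in the same number of steps from every state with probability at least some
  \<open>e > 0\<close>, so each such block of steps shrinks the oscillation of a conditional expectation by
  the factor \<open>1 - e\<close>.
\<close>

subsection \<open>Cesaro means\<close>

lemma time_avg_add: "time_avg (\<lambda>t. f t + g t) T = time_avg f T + time_avg g T"
  by (simp add: time_avg_def sum.distrib distrib_left)

lemma time_avg_diff: "time_avg (\<lambda>t. f t - g t) T = time_avg f T - time_avg g T"
  by (simp add: time_avg_def sum_subtractf right_diff_distrib)

lemma time_avg_mono: "(\<And>t. f t \<le> g t) \<Longrightarrow> time_avg f T \<le> time_avg g T"
  unfolding time_avg_def by (intro mult_left_mono sum_mono) auto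

lemma time_avg_const_tendsto: "time_avg (\<lambda>t. c) \<longlonglongrightarrow> c"
proof -
  \<comment> \<open>There are \<open>T + 1\<close> summands but the divisor is \<open>T\<close>,
    which leaves the extra term \<open>c / T\<close>. The formula fails at \<open>T = 0\<close>, so
    equality is claimed only eventually.\<close>
  have "(\<lambda>T. c + c * (1 / real T)) \<longlonglongrightarrow> c + c * 0"
    by (intro tendsto_intros lim_1_over_n)
  moreover have "\<forall>\<^sub>F T in sequentially. c + c * (1 / real T) = time_avg (\<lambda>t. c) T"
    using eventually_gt_at_top[of 0]
    by eventually_elim (simp add: time_avg_def field_simps)
  ultimately show ?thesis
    by (simp add: Lim_transform_eventually)
qed

text \<open>The terms up to some \<open>n0\<close> have a fixed total, which the factor
  \<open>1 / T\<close> makes small. Each later term is below \<open>r / 2\<close> in absolute value,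
  so that their average stays below \<open>r / 2\<close>.\<close>

lemma time_avg_tendsto_zero:
  assumes "y \<longlonglongrightarrow> 0"
  shows "time_avg y \<longlonglongrightarrow> 0"
proof (rule LIMSEQ_I)
  fix r :: real
  assume "r > 0"
  then obtain n0 where n0: "\<And>t. t \<ge> n0 \<Longrightarrow> \<bar>y t\<bar> < r / 2"
    using LIMSEQ_D[OF assms, of "r / 2"] by auto
  define C where "C = (\<Sum>t=0..n0. \<bar>y t\<bar>)"
  have bound: "(\<Sum>t=0..T. \<bar>y t\<bar>) \<le> C + real T * (r / 2)" if "T \<ge> n0" for T
    using that
  proof (induction T rule: dec_induct)
    case base
    then show ?case using \<open>r > 0\<close> by (simp add: C_def)
  next
    case (step T)
    then show ?case using n0[of "Suc T"] by (simp add: algebra_simps add_divide_distrib)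
  qed
  \<comment> \<open>The threshold is chosen so that \<open>C / T < r / 2\<close> for all larger
    \<open>T\<close>.\<close>
  obtain n1 where n1: "real n1 > 2 * C / r"
    using reals_Archimedean2 by blast
  show "\<exists>n. \<forall>T\<ge>n. norm (time_avg y T - 0) < r"
  proof (intro exI allI impI)
    fix T
    assume T: "T \<ge> max n0 (Suc n1)"
    then have "real T > 2 * C / r" "real T > 0" using n1 by auto
    then have C: "C < real T * (r / 2)"
      using \<open>r > 0\<close> by (simp add: field_simps)
    have "\<bar>\<Sum>t=0..T. y t\<bar> \<le> (\<Sum>t=0..T. \<bar>y t\<bar>)" by (rule sum_abs)
    also have "\<dots> \<le> C + real T * (r / 2)" using bound T by simp
    also have "\<dots> < real T * r" using C by simp
    finally show "norm (time_avg y T - 0) < r"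
      using \<open>real T > 0\<close> by (simp add: time_avg_def abs_mult field_simps)
  qed
qed

lemma time_avg_tendsto:
  assumes "x \<longlonglongrightarrow> c"
  shows "time_avg x \<longlonglongrightarrow> c"
proof -
  have "(\<lambda>t. x t - c) \<longlonglongrightarrow> 0"
    using assms by (simp add: LIM_zero)
  then have "(\<lambda>T. time_avg (\<lambda>t. x t - c) T + time_avg (\<lambda>t. c) T) \<longlonglongrightarrow> 0 + c"
    by (intro tendsto_add time_avg_tendsto_zero time_avg_const_tendsto)
  then show ?thesis
    by (simp flip: time_avg_add)
qed

subsection \<open>Ergodicity of the net generation\<close>

lemma expectation_bind_finite:
  fixes h :: "'b \<Rightarrow> real"
  assumes "finite (set_pmf p)" "\<And>x. x \<in> set_pmf p \<Longrightarrow> finite (set_pmf (f x))"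
  shows "measure_pmf.expectation (bind_pmf p f) h =
    measure_pmf.expectation p (\<lambda>x. measure_pmf.expectation (f x) h)"
  using assms
  by (subst pmf_expectation_bind[of "set_pmf p"]) (auto simp: integral_measure_pmf[of "set_pmf p"])

lemma expectation_bounds:
  fixes f :: "'a \<Rightarrow> real"
  assumes "finite (set_pmf p)" "\<And>x. x \<in> set_pmf p \<Longrightarrow> f x \<in> {l..u}"
  shows "measure_pmf.expectation p f \<in> {l..u}"
  using assms
  by (auto intro!: measure_pmf.integral_ge_const measure_pmf.integral_le_const
      integrable_measure_pmf_finite simp: AE_measure_pmf_iff)

text \<open>All terms of the expectation of \<open>f - l\<close> are nonnegative, so the term of the
  atom \<open>s\<close> alone is a lower bound. The bound on \<open>f\<close> is also required at
  \<open>s\<close> itself, which may lie outside the support.\<close>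

lemma expectation_atom_lower:
  fixes f :: "'a \<Rightarrow> real"
  assumes fin: "finite (set_pmf p)" and lower: "\<And>x. x \<in> insert s (set_pmf p) \<Longrightarrow> l \<le> f x"
    and "e \<le> pmf p s"
  shows "e * f s + (1 - e) * l \<le> measure_pmf.expectation p f"
proof -
  have "e * (f s - l) \<le> pmf p s * (f s - l)"
    using assms by (intro mult_right_mono) auto
  also have "\<dots> \<le> (\<Sum>x\<in>insert s (set_pmf p). pmf p x * (f x - l))"
    using assms by (intro member_le_sum) auto
  also have "\<dots> = measure_pmf.expectation p (\<lambda>x. f x - l)"
    using fin by (subst integral_measure_pmf[of "insert s (set_pmf p)"]) auto
  also have "\<dots> = measure_pmf.expectation p f - l"
    using fin by (simp add: integrable_measure_pmf_finite)
  finally show ?thesis by (simp add: algebra_simps)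
qed

text \<open>The upper bound is the lower bound applied to \<open>- f\<close>. Both ends share the
  shift \<open>e * f s\<close>, so the interval has length \<open>(1 - e) * (u - l)\<close>.\<close>

lemma expectation_atom_bounds:
  fixes f :: "'a \<Rightarrow> real"
  assumes "finite (set_pmf p)" and "\<And>x. x \<in> insert s (set_pmf p) \<Longrightarrow> f x \<in> {l..u}"
    and "e \<le> pmf p s"
  shows "measure_pmf.expectation p f \<in> {e * f s + (1 - e) * l..e * f s + (1 - e) * u}"
  using expectation_atom_lower[of p s l f e] expectation_atom_lower[of p s "- u" "\<lambda>x. - f x" e] assms
  by (auto simp: algebra_simps)

section \<open>Iterates of the kernel\<close>

text \<open>With the state argument removed, the recursion can rewrite \<open>step_law K k\<close>
  where it is passed unapplied to \<open>bind_pmf\<close>.\<close>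

lemma step_law_eq:
  "step_law K 0 = return_pmf"
  "step_law K (Suc k) = (\<lambda>s. bind_pmf (step_law K k s) K)"
  by (simp_all add: fun_eq_iff)

text \<open>This is the Chapman-Kolmogorov equation.\<close>

lemma step_law_add: "step_law K (j + k) s = bind_pmf (step_law K j s) (step_law K k)"
  by (induction k) (simp_all add: bind_return_pmf' bind_assoc_pmf)

lemma set_step_law: "kernel_on S K \<Longrightarrow> s \<in> S \<Longrightarrow> set_pmf (step_law K k s) \<subseteq> S"
  by (induction k) (auto simp: kernel_on_def)

lemma stationary_step_law:
  assumes "stationary_on S K p"
  shows "bind_pmf p (step_law K k) = p"
proof (induction k)
  case 0
  show ?case by (simp only: step_law_eq bind_return_pmf')
next
  case (Suc k)
  have "bind_pmf p (step_law K (Suc k)) = bind_pmf (bind_pmf p (step_law K k)) K"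
    by (simp only: step_law_eq bind_assoc_pmf)
  also have "\<dots> = p"
    using Suc assms by (simp add: stationary_on_def)
  finally show ?case .
qed

text \<open>Once at \<open>s'\<close>, the chain can wait there by using the self-loop.\<close>

lemma step_law_reaches_later:
  assumes "s' \<in> set_pmf (K s')" "s' \<in> set_pmf (step_law K k s)" "k \<le> n"
  shows "s' \<in> set_pmf (step_law K n s)"
  using assms(3) by (induction n rule: dec_induct) (use assms in auto)

text \<open>Irreducibility gives a hitting time of \<open>s0\<close> that varies with the starting
  state. Waiting at \<open>s0\<close> brings all of them to a common time \<open>N\<close>, and the
  least of finitely many positive probabilities serves as \<open>e\<close>.\<close>

lemma doeblin_minorization:
  assumes "finite S" "s0 \<in> S" "irreducible_on S K" "pmf (K s0) s0 > 0"
  obtains N e where "e > 0" "\<And>s. s \<in> S \<Longrightarrow> e \<le> pmf (step_law K N s) s0"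
proof -
  have "\<forall>s\<in>S. \<exists>k. s0 \<in> set_pmf (step_law K k s)"
    using assms unfolding irreducible_on_def by (metis less_irrefl set_pmf_iff)
  then obtain k where k: "\<And>s. s \<in> S \<Longrightarrow> s0 \<in> set_pmf (step_law K (k s) s)"
    by metis
  \<comment> \<open>The sum over \<open>S\<close> dominates every \<open>k s\<close>.\<close>
  define N where "N = (\<Sum>s\<in>S. k s)"
  have "s0 \<in> set_pmf (step_law K N s)" if "s \<in> S" for s
  proof (rule step_law_reaches_later[OF _ k[OF that]])
    show "s0 \<in> set_pmf (K s0)" using assms(4) by (simp add: set_pmf_iff)
    show "k s \<le> N" unfolding N_def using that assms(1) by (intro member_le_sum) auto
  qed
  then have "Min ((\<lambda>s. pmf (step_law K N s) s0) ` S) > 0"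
    using assms(1,2) by (subst Min_gr_iff) (auto simp: pmf_positive)
  then show ?thesis
    using assms(1) by (intro that[of _ N]) auto
qed

section \<open>Contraction and convergence on a finite state space\<close>

locale finite_chain =
  fixes S :: "'s set" and K :: "'s kernel"
  assumes finite_S: "finite S" and kernel: "kernel_on S K"
begin

lemma finite_step_law: "s \<in> S \<Longrightarrow> finite (set_pmf (step_law K k s))"
  using set_step_law[OF kernel] finite_S finite_subset by metis

lemma expectation_step_law_add:
  fixes f :: "'s \<Rightarrow> real"
  assumes "s \<in> S"
  shows "measure_pmf.expectation (step_law K (j + k) s) f =
    measure_pmf.expectation (step_law K j s) (\<lambda>s'. measure_pmf.expectation (step_law K k s') f)"
  unfolding step_law_add using set_step_law[OF kernel assms] assms
  by (intro expectation_bind_finite finite_step_law) auto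

text \<open>After \<open>N\<close> steps the laws from all starting states have mass at least
  \<open>e\<close> at \<open>s0\<close>, so only a weight \<open>1 - e\<close> is left to separate
  their expectations. The position of each new interval depends on a value at \<open>s0\<close>;
  hence the endpoints are existential while the length is explicit.\<close>

lemma oscillation_contracts:
  fixes f :: "'s \<Rightarrow> real"
  assumes "s0 \<in> S" and minor: "\<And>s. s \<in> S \<Longrightarrow> e \<le> pmf (step_law K N s) s0"
    and f: "\<And>s. s \<in> S \<Longrightarrow> f s \<in> {l..u}"
  shows "\<exists>l' u'. u' - l' = (1 - e) ^ j * (u - l) \<and>
    (\<forall>s\<in>S. measure_pmf.expectation (step_law K (j * N) s) f \<in> {l'..u'})"
proof (induction j)
  case 0
  show ?case using f by auto
next
  case (Suc j)
  define g where "g s = measure_pmf.expectation (step_law K (j * N) s) f" for s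
  from Suc obtain l' u' where lu: "u' - l' = (1 - e) ^ j * (u - l)"
    and g: "\<And>s. s \<in> S \<Longrightarrow> g s \<in> {l'..u'}"
    unfolding g_def by blast
  have "measure_pmf.expectation (step_law K (Suc j * N) s) f
      \<in> {e * g s0 + (1 - e) * l'..e * g s0 + (1 - e) * u'}" if "s \<in> S" for s
  proof -
    \<comment> \<open>The first block of \<open>N\<close> steps is split off, so that the
      minorization acts on an average of \<open>g\<close>.\<close>
    have "measure_pmf.expectation (step_law K (Suc j * N) s) f =
        measure_pmf.expectation (step_law K N s) g"
      using expectation_step_law_add[OF that, of N "j * N" f] by (simp add: g_def[abs_def])
    then show ?thesis
      using expectation_atom_bounds[of "step_law K N s" s0 g l' u' e]
        finite_step_law[OF that] minor[OF that] set_step_law[OF kernel that] g \<open>s0 \<in> S\<close>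
      by auto
  qed
  moreover have "(e * g s0 + (1 - e) * u') - (e * g s0 + (1 - e) * l') = (1 - e) ^ Suc j * (u - l)"
    using lu by (simp add: mult.assoc flip: right_diff_distrib)
  ultimately show ?case by blast
qed

text \<open>Averaging cannot leave an interval, so one short interval contains the expectations at
  all late times from every initial law on \<open>S\<close>. The stationary law is one of these
  laws, and its expectation is constant in time.\<close>

lemma expectation_step_law_tendsto:
  fixes f :: "'s \<Rightarrow> real"
  assumes irred: "irreducible_on S K" and loops: "\<And>s. s \<in> S \<Longrightarrow> pmf (K s) s > 0"
    and stat: "stationary_on S K p" and q: "set_pmf q \<subseteq> S"
  shows "(\<lambda>t. measure_pmf.expectation (bind_pmf q (step_law K t)) f)
    \<longlonglongrightarrow> measure_pmf.expectation p f"
proof (rule LIMSEQ_I)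
  fix r :: real
  assume "r > 0"
  have p: "set_pmf p \<subseteq> S" using stat by (simp add: stationary_on_def)
  obtain s0 where "s0 \<in> S" using p set_pmf_not_empty[of p] by blast
  obtain N e where e: "e > 0" and minor: "\<And>s. s \<in> S \<Longrightarrow> e \<le> pmf (step_law K N s) s0"
    by (rule doeblin_minorization[OF finite_S \<open>s0 \<in> S\<close> irred loops[OF \<open>s0 \<in> S\<close>]]) blast
  have "e \<le> 1" using minor[OF \<open>s0 \<in> S\<close>] pmf_le_1 by (rule order_trans)
  define l u where "l = Min (f ` S)" and "u = Max (f ` S)"
  have f: "f s \<in> {l..u}" if "s \<in> S" for s
    using that finite_S by (auto simp: l_def u_def)
  have "(\<lambda>j. (1 - e) ^ j * (u - l)) \<longlonglongrightarrow> 0 * (u - l)"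
    using e \<open>e \<le> 1\<close> by (intro tendsto_mult LIMSEQ_power_zero) auto
  then obtain j where j: "\<bar>(1 - e) ^ j * (u - l)\<bar> < r"
    using LIMSEQ_D[of "\<lambda>j. (1 - e) ^ j * (u - l)" 0 r] \<open>r > 0\<close> by auto
  obtain l' u' where lu: "u' - l' = (1 - e) ^ j * (u - l)"
    and osc: "\<And>s. s \<in> S \<Longrightarrow> measure_pmf.expectation (step_law K (j * N) s) f \<in> {l'..u'}"
    using oscillation_contracts[of s0 e N f l u j, OF \<open>s0 \<in> S\<close> minor f] by blast
  \<comment> \<open>The last \<open>j * N\<close> steps do the contracting; the \<open>m\<close>
    steps before them and the initial law only average values already in the interval.\<close>
  have late: "measure_pmf.expectation (bind_pmf q' (step_law K t)) f \<in> {l'..u'}"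
    if "t \<ge> j * N" "set_pmf q' \<subseteq> S" for t q'
  proof -
    obtain m where t: "t = m + j * N"
      using \<open>t \<ge> j * N\<close> by (metis add.commute le_Suc_ex)
    have "measure_pmf.expectation (step_law K t s) f \<in> {l'..u'}" if "s \<in> S" for s
      unfolding t expectation_step_law_add[OF that]
      using osc set_step_law[OF kernel that]
      by (intro expectation_bounds[OF finite_step_law[OF that]]) blast
    moreover have "finite (set_pmf q')"
      using \<open>set_pmf q' \<subseteq> S\<close> finite_S by (rule finite_subset)
    ultimately show ?thesis
      using \<open>set_pmf q' \<subseteq> S\<close> finite_step_law
      by (subst expectation_bind_finite; blast intro: expectation_bounds)
  qed
  show "\<exists>n. \<forall>t\<ge>n. norm (measure_pmf.expectation (bind_pmf q (step_law K t)) f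
      - measure_pmf.expectation p f) < r"
  proof (intro exI allI impI)
    fix t
    assume t: "t \<ge> j * N"
    show "norm (measure_pmf.expectation (bind_pmf q (step_law K t)) f
        - measure_pmf.expectation p f) < r"
      using late[OF t q] late[OF t p] j lu unfolding stationary_step_law[OF stat] by auto
  qed
qed

end

subsection \<open>The controlled process\<close>

text \<open>The kernel step depends on \<open>x\<close> alone, so summing out the action and the
  battery level leaves the autonomous chain.\<close>

lemma map_run:
  "map_pmf (\<lambda>(h, x, b). x) (run init K \<sigma> t) = bind_pmf (map_pmf fst init) (step_law K t)"
proof (induction t)
  case 0
  show ?case by (simp add: map_pmf_comp split_beta step_law_eq(1) bind_return_pmf')
next
  case (Suc t)
  have "map_pmf (\<lambda>(h, x, b). x) (run init K \<sigma> (Suc t)) =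
      bind_pmf (map_pmf (\<lambda>(h, x, b). x) (run init K \<sigma> t)) K"
    by (simp add: map_bind_pmf map_pmf_comp bind_map_pmf split_beta)
  also have "\<dots> = bind_pmf (map_pmf fst init) (step_law K (Suc t))"
    by (simp only: Suc bind_assoc_pmf step_law_eq(2))
  finally show ?case .
qed

lemma map_fst_law_XBA:
  "map_pmf fst (law_XBA init K \<sigma> t) = bind_pmf (map_pmf fst init) (step_law K t)"
proof -
  have "map_pmf fst (law_XBA init K \<sigma> t) = map_pmf (\<lambda>(h, x, b). x) (run init K \<sigma> t)"
    unfolding law_XBA_def
    by (simp add: map_bind_pmf map_pmf_comp split_beta map_pmf_def[of _ "run init K \<sigma> t"])
  then show ?thesis by (simp add: map_run)
qed

text \<open>This is an invariant: the kernel keeps \<open>x\<close> in \<open>S\<close>, and the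
  capacity condition in \<open>actions\<close> keeps the next level in range.\<close>

lemma set_run:
  assumes "kernel_on S K" "set_pmf init \<subseteq> S \<times> {0..int bmax}" "admissible S bmax \<sigma>"
    and "(h, x, b) \<in> set_pmf (run init K \<sigma> t)"
  shows "x \<in> S \<and> b \<in> {0..int bmax}"
  using assms(4)
proof (induction t arbitrary: h x b)
  case 0
  then show ?case using assms(2) by auto
next
  case (Suc t)
  then obtain h' x' b' a where run: "(h', x', b') \<in> set_pmf (run init K \<sigma> t)"
    and a: "a \<in> set_pmf (\<sigma> h' x' b')" and x: "x \<in> set_pmf (K x')"
    and b: "b = b' + (\<Sum>i\<in>UNIV. a i)"
    by auto
  note IH = Suc.IH[OF run]
  then have "a \<in> actions bmax x' b'"
    using a assms(3) unfolding admissible_def by blast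
  then show ?case
    using IH x b assms(1) by (auto simp: kernel_on_def actions_def)
qed

lemma set_law_XBA:
  assumes "kernel_on S K" "set_pmf init \<subseteq> S \<times> {0..int bmax}" "admissible S bmax \<sigma>"
    and "(x, b, a) \<in> set_pmf (law_XBA init K \<sigma> t)"
  shows "x \<in> S \<and> a \<in> actions bmax x b"
proof -
  obtain h where "(h, x, b) \<in> set_pmf (run init K \<sigma> t)" "a \<in> set_pmf (\<sigma> h x b)"
    using assms(4) by (auto simp: law_XBA_def)
  then show ?thesis
    using set_run[OF assms(1-3)] assms(3) unfolding admissible_def by blast
qed

section \<open>Bounds on actions and losses\<close>

lemma actions_component:
  assumes "a \<in> actions bmax x b"
  shows "\<bar>a i\<bar> \<le> \<bar>x i\<bar>" "a i \<ge> min (x i) 0" "x i \<ge> 0 \<Longrightarrow> a i \<le> x i"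
proof -
  have "a i \<in> (if x i \<ge> 0 then {0..x i} else {x i..0})"
    using assms by (simp add: actions_def)
  then show "\<bar>a i\<bar> \<le> \<bar>x i\<bar>" "a i \<ge> min (x i) 0" "x i \<ge> 0 \<Longrightarrow> a i \<le> x i"
    by (auto split: if_splits)
qed

text \<open>If \<open>x i < 0\<close>, the loss is \<open>a i - x i\<close>, nonnegative because at
  most the deficit is supplied. Otherwise the loss is zero and \<open>a i \<le> x i\<close>. Both
  bounds then pass to expectations.\<close>

lemma loss_nonneg_and_ge:
  fixes S :: "'n::finite vec_int set"
  assumes fin: "finite S"
    and proc: "kernel_on S K" "set_pmf init \<subseteq> S \<times> {0..int bmax}" "admissible S bmax \<sigma>"
  shows "loss init K \<sigma> i t \<ge> 0"
    and "loss init K \<sigma> i t \<ge> mean_action init K \<sigma> i t -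
      measure_pmf.expectation (bind_pmf (map_pmf fst init) (step_law K t)) (\<lambda>s. real_of_int (s i))"
proof -
  let ?L = "law_XBA init K \<sigma> t"
  let ?l = "\<lambda>(x :: 'n vec_int, b :: int, a :: 'n vec_int). of_bool (x i < 0) * real_of_int (a i - x i)"
  let ?a = "\<lambda>(x :: 'n vec_int, b :: int, a :: 'n vec_int). real_of_int (a i)"
  let ?x = "\<lambda>z :: 'n vec_int \<times> int \<times> 'n vec_int. real_of_int (fst z i)"
  note supp = set_law_XBA[OF proc]
  have nonneg: "0 \<le> ?l z" if "z \<in> set_pmf ?L" for z
    using that by (cases z) (auto dest!: supp dest: actions_component(2)[of _ _ _ _ i])
  then show "loss init K \<sigma> i t \<ge> 0"
    unfolding loss_def by (intro integral_nonneg_AE) (simp only: AE_measure_pmf_iff, blast)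
  have ge: "?a z - ?x z \<le> ?l z" if "z \<in> set_pmf ?L" for z
    using that by (cases z) (auto dest!: supp dest: actions_component(3)[of _ _ _ _ i])
  \<comment> \<open>\<open>M\<close> bounds the net generation of user \<open>i\<close> on
    \<open>S\<close>, and with it the size of allowable actions. The resulting integrability lets
    expectations be subtracted and compared.\<close>
  define M where "M = (\<Sum>s\<in>S. \<bar>s i\<bar>)"
  have M: "\<bar>s i\<bar> \<le> M" if "s \<in> S" for s
    using that fin unfolding M_def by (intro member_le_sum) auto
  have bound: "\<bar>?x z\<bar> \<le> M \<and> \<bar>?a z\<bar> \<le> M" if zL: "z \<in> set_pmf ?L" for z
  proof -
    obtain x b a where z: "z = (x, b, a)" by (cases z)
    have x: "x \<in> S" and a: "a \<in> actions bmax x b" using supp zL z by blast+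
    have "\<bar>a i\<bar> \<le> M" using actions_component(1)[OF a, of i] M[OF x] by linarith
    then show ?thesis using M[OF x] unfolding z by simp linarith
  qed
  have int_x: "integrable ?L ?x" and int_a: "integrable ?L ?a"
    by (rule measure_pmf.integrable_const_bound[where B = M];
        use bound in \<open>simp add: AE_measure_pmf_iff\<close>)+
  have loss_le: "\<bar>?l z\<bar> \<le> \<bar>?a z\<bar> + \<bar>?x z\<bar>" for z
    by (cases z) auto
  have "\<bar>?l z\<bar> \<le> 2 * real_of_int M" if "z \<in> set_pmf ?L" for z
    using bound[OF that] loss_le[of z] by linarith
  then have int_l: "integrable ?L ?l"
    by (intro measure_pmf.integrable_const_bound[where B = "2 * M"])
      (simp_all add: AE_measure_pmf_iff)
  \<comment> \<open>The mean of \<open>x i\<close> only sees the marginal law of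
    \<open>X(t)\<close>.\<close>
  have "measure_pmf.expectation (bind_pmf (map_pmf fst init) (step_law K t)) (\<lambda>s. real_of_int (s i))
      = measure_pmf.expectation ?L ?x"
    by (simp flip: map_fst_law_XBA[of init K \<sigma> t])
  then have "mean_action init K \<sigma> i t -
      measure_pmf.expectation (bind_pmf (map_pmf fst init) (step_law K t)) (\<lambda>s. real_of_int (s i))
      = measure_pmf.expectation ?L (\<lambda>z. ?a z - ?x z)"
    using int_a int_x by (simp add: mean_action_def)
  also have "\<dots> \<le> measure_pmf.expectation ?L ?l"
    using int_a int_x int_l ge
    by (intro integral_mono_AE) (simp_all only: AE_measure_pmf_iff Bochner_Integration.integrable_diff, blast)
  finally show "loss init K \<sigma> i t \<ge> mean_action init K \<sigma> i t -
      measure_pmf.expectation (bind_pmf (map_pmf fst init) (step_law K t)) (\<lambda>s. real_of_int (s i))"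
    by (simp add: loss_def)
qed

theorem mainTheorem1:
  fixes Si :: "'n::finite \<Rightarrow> int set"
    and S :: "('n \<Rightarrow> int) set"
    and K :: "('n \<Rightarrow> int) \<Rightarrow> ('n \<Rightarrow> int) pmf"
    and \<pi> :: "('n \<Rightarrow> int) pmf"
    and bmax :: nat
    and init :: "(('n \<Rightarrow> int) \<times> int) pmf"
    and \<sigma> :: "'n policy"
  assumes "\<And>i. finite (Si i)" and "\<And>i. Si i \<noteq> {}"
    and "\<And>i. Max (Si i) > 0" and "\<And>i. Min (Si i) < 0"
    and "finite S" and "S \<subseteq> {s. \<forall>i. s i \<in> Si i}"
    and "kernel_on S K" and "irreducible_on S K"
    and "\<And>s. s \<in> S \<Longrightarrow> pmf (K s) s > 0"
    and "stationary_on S K \<pi>"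
    and "set_pmf init \<subseteq> S \<times> {0..int bmax}"
    and "admissible S bmax \<sigma>"
    and "\<And>i. LLR_exists init K \<sigma> i"
    and "\<And>i. FC init K \<sigma> i"
  shows "LLR_sys init K \<sigma> \<ge> (\<Sum>i\<in>net_demanding S \<pi>. - drift S \<pi> i)"
proof -
  interpret finite_chain S K
    using \<open>finite S\<close> \<open>kernel_on S K\<close> by unfold_locales
  note loss_bounds = loss_nonneg_and_ge[OF \<open>finite S\<close> \<open>kernel_on S K\<close>
      \<open>set_pmf init \<subseteq> S \<times> {0..int bmax}\<close> \<open>admissible S bmax \<sigma>\<close>]
  have LLR: "time_avg (loss init K \<sigma> i) \<longlonglongrightarrow> LLR init K \<sigma> i" for i
    using \<open>LLR_exists init K \<sigma> i\<close> by (simp add: LLR_exists_def LLR_def convergent_LIMSEQ_iff)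
  have LLR_nonneg: "LLR init K \<sigma> i \<ge> 0" for i
    using LLR by (rule LIMSEQ_le_const)
      (auto simp: time_avg_def intro!: divide_nonneg_nonneg sum_nonneg loss_bounds(1))
  have LLR_ge: "LLR init K \<sigma> i \<ge> - drift S \<pi> i" for i
  proof -
    define \<xi> where "\<xi> t = measure_pmf.expectation
      (bind_pmf (map_pmf fst init) (step_law K t)) (\<lambda>s. real_of_int (s i))" for t
    have "measure_pmf.expectation \<pi> (\<lambda>s. real_of_int (s i)) = drift S \<pi> i"
      unfolding drift_def using \<open>finite S\<close> \<open>stationary_on S K \<pi>\<close>
      by (intro integral_measure_pmf_real) (auto simp: stationary_on_def)
    moreover have "set_pmf (map_pmf fst init) \<subseteq> S"
      using \<open>set_pmf init \<subseteq> _\<close> by auto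
    ultimately have "\<xi> \<longlonglongrightarrow> drift S \<pi> i"
      unfolding \<xi>_def
      using expectation_step_law_tendsto[OF assms(8) assms(9) assms(10),
          of "map_pmf fst init" "\<lambda>s. real_of_int (s i)"] by simp
    then have \<xi>: "time_avg \<xi> \<longlonglongrightarrow> drift S \<pi> i"
      by (rule time_avg_tendsto)
    obtain A where A: "time_avg (mean_action init K \<sigma> i) \<longlonglongrightarrow> A" "A \<ge> 0"
      using \<open>FC init K \<sigma> i\<close> by (auto simp: FC_def convergent_LIMSEQ_iff)
    \<comment> \<open>The bound at each time survives averaging. The left side tends to
      \<open>A - drift S \<pi> i\<close>, where fairness supplies \<open>A \<ge> 0\<close>.\<close>
    have "time_avg (mean_action init K \<sigma> i) T - time_avg \<xi> T \<le> time_avg (loss init K \<sigma> i) T" for T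
      unfolding time_avg_diff[symmetric] \<xi>_def by (intro time_avg_mono loss_bounds(2))
    then have "A - drift S \<pi> i \<le> LLR init K \<sigma> i"
      by (intro LIMSEQ_le[OF tendsto_diff[OF A(1) \<xi>] LLR]) auto
    then show ?thesis using \<open>A \<ge> 0\<close> by simp
  qed
  have "(\<Sum>i\<in>net_demanding S \<pi>. - drift S \<pi> i) \<le> (\<Sum>i\<in>net_demanding S \<pi>. LLR init K \<sigma> i)"
    by (intro sum_mono LLR_ge)
  \<comment> \<open>The remaining users have nonnegative loss rates, so extending the sum to all
    users cannot decrease it.\<close>
  also have "\<dots> \<le> LLR_sys init K \<sigma>"
    unfolding LLR_sys_def by (intro sum_mono2) (auto intro: LLR_nonneg)
  finally show ?thesis .
qed

end
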